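(* Let $\Sigma=\{\mathtt{a},\mathtt{b}\}$, $k\in\mathbb{N}$ and $w\in\Sigma^*$ with $\alpha$-$\beta$-factorization $w=\alpha_0\beta_1\alpha_1\cdots\beta_{\iota(w)}\alpha_{\iota(w)}$. Then the following are equivalent: (i) $|[w]_{\sim_k}|<\infty$; (ii) $|[w]_{\sim_k}|=1$; (iii) $\iota(w)<k$ and $|\alpha_i|<k-\iota(w)$ for all $i\in\{0,\dots,\iota(w)\}$.
   Context: A word $u$ is a scattered factor of $w$ if $u$ is obtained from $w$ by deleting some letters (keeping order). For $k\in\mathbb{N}_0$, $u\sim_k v$ iff $u$ and $v$ have exactly the same scattered factors of length at most $k$; $[w]_{\sim_k}$ denotes the congruence class of $w$ in $\Sigma^*$. $\iota(w)$ is the largest $\ell$ such that every word of $\Sigma^\ell$ is a scattered factor of $w$. The arch factorization of $w$ is the unique factorization $w=\mathrm{ar}_1(w)\cdots\mathrm{ar}_\ell(w)\mathrm{re}(w)$ where each arch contains every letter of $\Sigma$ and its last letter occurs exactly once in it, and $\mathrm{re}(w)$ does not contain every letter of $\Sigma$; $\ell=\iota(w)$. With $w^R$ the reversal, $\mathrm{ra}_i(w)\coloneqq(\mathrm{ar}_{\iota(w)-i+1}(w^R))^R$ and $\mathrm{er}(w)\coloneqq(\mathrm{re}(w^R))^R$. The $\alpha$-$\beta$-factorization is $w=\alpha_0\beta_1\alpha_1\cdots\beta_{\iota(w)}\alpha_{\iota(w)}$ with $\mathrm{ar}_i(w)=\alpha_{i-1}\beta_i$, $\mathrm{ra}_i(w)=\beta_i\alpha_i$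 for $i\in\{1,\dots,\iota(w)\}$, $\alpha_0=\mathrm{er}(w)$, $\alpha_{\iota(w)}=\mathrm{re}(w)$. *)

theory Defs
  imports Main "HOL-Library.Sublist"
begin

text \<open>
  Words over the alphabet \<open>S\<close> are the elements of \<open>lists S\<close>, and \<open>u\<close> is a scattered factor
  of \<open>w\<close> iff \<open>subseq u w\<close>.
\<close>

definition simon_cong :: "nat \<Rightarrow> 'a list \<Rightarrow> 'a list \<Rightarrow> bool" where
  "simon_cong k u v \<longleftrightarrow>
     {x. subseq x u \<and> length x \<le> k} = {x. subseq x v \<and> length x \<le> k}"

definition simon_class :: "'a set \<Rightarrow> nat \<Rightarrow> 'a list \<Rightarrow> 'a list set" where
  "simon_class S k w = {v \<in> lists S. simon_cong k w v}"

definition iota :: "'a set \<Rightarrow> 'a list \<Rightarrow> nat" where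
  "iota S w = (GREATEST l. \<forall>u \<in> lists S. length u = l \<longrightarrow> subseq u w)"

definition is_arch :: "'a set \<Rightarrow> 'a list \<Rightarrow> bool" where
  "is_arch S u \<longleftrightarrow> u \<noteq> [] \<and> set u = S \<and> count_list u (last u) = 1"

definition is_arch_fact :: "'a set \<Rightarrow> 'a list \<Rightarrow> 'a list list \<Rightarrow> 'a list \<Rightarrow> bool" where
  "is_arch_fact S w us r \<longleftrightarrow>
     w = concat us @ r \<and> (\<forall>u \<in> set us. is_arch S u) \<and> \<not> S \<subseteq> set r"

definition arch_fact :: "'a set \<Rightarrow> 'a list \<Rightarrow> 'a list list \<times> 'a list" where
  "arch_fact S w = (THE (us, r). is_arch_fact S w us r)"

text \<open>Arches are numbered from 1.\<close>

definition ar :: "'a set \<Rightarrow> nat \<Rightarrow> 'a list \<Rightarrow> 'a list" where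
  "ar S i w = fst (arch_fact S w) ! (i - 1)"

definition re :: "'a set \<Rightarrow> 'a list \<Rightarrow> 'a list" where
  "re S w = snd (arch_fact S w)"

definition ra :: "'a set \<Rightarrow> nat \<Rightarrow> 'a list \<Rightarrow> 'a list" where
  "ra S i w = rev (ar S (iota S w - i + 1) (rev w))"

definition er :: "'a set \<Rightarrow> 'a list \<Rightarrow> 'a list" where
  "er S w = rev (re S (rev w))"

text \<open>
  The factors are given by functions \<open>\<alpha>\<close> and \<open>\<beta>\<close>, of which only \<open>\<alpha> 0, \<dots>, \<alpha> (iota S w)\<close> and
  \<open>\<beta> 1, \<dots>, \<beta> (iota S w)\<close> are relevant.
\<close>

definition alpha_beta_fact ::
  "'a set \<Rightarrow> 'a list \<Rightarrow> (nat \<Rightarrow> 'a list) \<Rightarrow> (nat \<Rightarrow> 'a list) \<Rightarrow> bool" where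
  "alpha_beta_fact S w \<alpha> \<beta> \<longleftrightarrow>
     w = \<alpha> 0 @ concat (map (\<lambda>i. \<beta> i @ \<alpha> i) [1..<iota S w + 1]) \<and>
     (\<forall>i \<in> {1..iota S w}. ar S i w = \<alpha> (i - 1) @ \<beta> i \<and> ra S i w = \<beta> i @ \<alpha> i) \<and>
     \<alpha> 0 = er S w \<and> \<alpha> (iota S w) = re S w"

text \<open>Existence and uniqueness of the arch factorization justify the definite description.\<close>

lemma is_arch_altdef:
  "is_arch S u \<longleftrightarrow> (\<exists>v x. u = v @ [x] \<and> x \<notin> set v \<and> S = insert x (set v))"
proof (cases u rule: rev_cases)
  case Nil
  then show ?thesis by (simp add: is_arch_def)
next
  case (snoc v x)
  then show ?thesis
    by (auto simp: is_arch_def count_list_0_iff)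
qed

lemma is_arch_prefix_eq:
  assumes "is_arch S u" "is_arch S v" "u @ xs = v @ ys"
  shows "u = v"
proof -
  have aux: "p = q" if "is_arch S p" "is_arch S q" "q = p @ d" for p q d
  proof (cases d rule: rev_cases)
    case (snoc e x)
    then show ?thesis using that by (auto simp: is_arch_altdef)
  qed (use that in simp)
  from assms(3) obtain d where "u = v @ d \<or> v = u @ d"
    by (auto simp: append_eq_append_conv2)
  then show ?thesis using aux assms(1,2) by metis
qed

lemma is_arch_fact_unique:
  assumes "is_arch_fact S w us r" "is_arch_fact S w us' r'"
  shows "us = us' \<and> r = r'"
  using assms
proof (induction us arbitrary: w us')
  case Nil
  then show ?case
    by (cases us') (auto simp: is_arch_fact_def is_arch_def)
next
  case (Cons u us)
  then obtain v vs where us': "us' = v # vs"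
    by (cases us') (auto simp: is_arch_fact_def is_arch_def)
  have "u = v"
    using Cons.prems is_arch_prefix_eq[of S u v "concat us @ r" "concat vs @ r'"]
    by (auto simp: is_arch_fact_def us')
  then show ?case
    using Cons.prems Cons.IH[of "concat us @ r" vs] by (auto simp: is_arch_fact_def us')
qed

lemma is_arch_prefix_exists:
  assumes "w \<in> lists S" "S \<subseteq> set w" "S \<noteq> {}"
  shows "\<exists>u v. w = u @ v \<and> is_arch S u"
  using assms
proof (induction w rule: rev_induct)
  case (snoc x w)
  show ?case
  proof (cases "S \<subseteq> set w")
    case True
    then obtain u v where "w = u @ v" "is_arch S u"
      using snoc by auto
    then show ?thesis by (intro exI[of _ u] exI[of _ "v @ [x]"]) simp
  next
    case False
    then have "is_arch S (w @ [x])"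
      using snoc.prems by (auto simp: is_arch_altdef)
    then show ?thesis by (intro exI[of _ "w @ [x]"] exI[of _ "[]"]) simp
  qed
qed simp

lemma is_arch_fact_exists:
  assumes "w \<in> lists S" "S \<noteq> {}"
  shows "\<exists>us r. is_arch_fact S w us r"
  using assms
proof (induction w rule: length_induct)
  case (1 w)
  show ?case
  proof (cases "S \<subseteq> set w")
    case True
    then obtain u v where uv: "w = u @ v" "is_arch S u"
      using is_arch_prefix_exists 1 by metis
    then have "length v < length w" "v \<in> lists S"
      using 1 by (auto simp: is_arch_def)
    then obtain us r where "is_arch_fact S v us r"
      using 1 by metis
    then have "is_arch_fact S w (u # us) r"
      using uv by (auto simp: is_arch_fact_def)
    then show ?thesis by blast
  next
    case False
    then have "is_arch_fact S w [] w" by (simp add: is_arch_fact_def)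
    then show ?thesis by blast
  qed
qed

lemma is_arch_fact_arch_fact:
  assumes "w \<in> lists S" "S \<noteq> {}"
  shows "is_arch_fact S w (fst (arch_fact S w)) (snd (arch_fact S w))"
proof -
  obtain us r where f: "is_arch_fact S w us r"
    using is_arch_fact_exists[OF assms] by blast
  then have "arch_fact S w = (us, r)"
    unfolding arch_fact_def by (intro the_equality) (auto dest: is_arch_fact_unique)
  with f show ?thesis by simp
qed

end

theory Submission
  imports Defs
begin

text \<open>
  Write \<open>l\<close> for \<open>iota S w\<close>. In \<open>w = p @ \<alpha>\<^sub>i @ q\<close> the factor \<open>p\<close> contains all words of length \<open>i\<close>
  and \<open>q\<close> all words of length \<open>l - i\<close>, so a word of length at most \<open>k\<close> needs at most \<open>k - l\<close>
  letters of \<open>\<alpha>\<^sub>i\<close>. Over a binary alphabet \<open>\<alpha>\<^sub>i\<close> is a power of a letter, so it can be pumped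
  without leaving the class as soon as its length reaches \<open>k - l\<close>.

  Conversely, if \<open>v\<close> is congruent to \<open>w\<close> and \<open>l < k\<close>, then \<open>v\<close> has \<open>l\<close> arches, too. The word of
  the last letters of the first \<open>i\<close> arches of \<open>v\<close> and the word of the first letters of its last
  \<open>l - i\<close> reversed arches force whatever is read between them to lie in the factor \<open>\<alpha>\<^sub>i\<close> of \<open>v\<close>,
  while by universality they also occur around the factor \<open>\<alpha>\<^sub>i\<close> of \<open>w\<close>. Hence corresponding
  factors \<open>\<alpha>\<^sub>i\<close> are congruent at level \<open>k - l\<close>, thus equal if they are shorter than that, and the
  factors \<open>\<alpha>\<^bsub>i-1\<^esub> @ \<beta>\<^sub>i @ \<alpha>\<^sub>i\<close> are congruent at level \<open>k - l + 1 \<ge> 2\<close>, which determines \<open>\<beta>\<^sub>i\<close> in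
  the binary case.
\<close>

section \<open>Scattered factors and Simon's congruence\<close>

lemma simon_cong_iff:
  "simon_cong k u v \<longleftrightarrow> (\<forall>x. length x \<le> k \<longrightarrow> (subseq x u \<longleftrightarrow> subseq x v))"
  by (auto simp: simon_cong_def)

lemma simon_congD: "simon_cong k u v \<Longrightarrow> subseq x u \<Longrightarrow> length x \<le> k \<Longrightarrow> subseq x v"
  by (auto simp: simon_cong_def)

lemma simon_cong_sym: "simon_cong k u v \<Longrightarrow> simon_cong k v u"
  by (simp add: simon_cong_def)

lemma subseq_rev: "subseq (rev u) (rev v) \<longleftrightarrow> subseq u v"
proof -
  have "subseq (rev u) (rev v)" if "subseq u v" for u v :: "'a list"
    using that by induction (auto intro: list_emb_append_mono)
  from this[of u v] this[of "rev u" "rev v"] show ?thesis by auto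
qed

lemma subseq_imp_subset: "subseq u v \<Longrightarrow> set u \<subseteq> set v"
  by (auto elim: list_emb_set)

text \<open>The displayed \<open>x\<close> is the first one in \<open>p @ x # v\<close>, so whatever
  follows \<open>x\<close> in the embedded word is read after it.\<close>

lemma subseq_Cons_append_notin:
  assumes "subseq (x # u) (p @ x # v)" "x \<notin> set p"
  shows "subseq u v"
  using assms by (induction p) auto

lemma subseq_append_Cons_notin:
  assumes "subseq (u @ [x]) (p @ x # v)" "x \<notin> set v"
  shows "subseq u p"
proof -
  have "subseq (rev (u @ [x])) (rev (p @ x # v))"
    using assms(1) by (simp only: subseq_rev)
  then have "subseq (rev u) (rev p)"
    using subseq_Cons_append_notin[of x "rev u" "rev v" "rev p"] assms(2) by simp
  then show ?thesis by (simp only: subseq_rev)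
qed

text \<open>If \<open>v\<close> were longer than \<open>u\<close>, its prefix of length
  \<open>Suc (length u)\<close> would still be within level \<open>k\<close>, hence a scattered
  factor of the shorter \<open>u\<close>.\<close>

lemma simon_cong_short_eq:
  assumes "simon_cong k u v" "length u < k"
  shows "u = v"
proof -
  have uv: "subseq u v"
    using simon_congD[OF assms(1), of u] assms(2) by simp
  have "length v \<le> length u"
  proof (rule ccontr)
    assume "\<not> length v \<le> length u"
    then have len: "length (take (Suc (length u)) v) = Suc (length u)" by simp
    have "subseq (take (Suc (length u)) v) v"
      by (simp add: prefix_imp_subseq take_is_prefix)
    then have "subseq (take (Suc (length u)) v) u"
      by (rule simon_congD[OF simon_cong_sym[OF assms(1)]]) (use assms(2) len in simp)
    then show False
      using list_emb_length len by fastforce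
  qed
  then show ?thesis
    using uv by (metis le_antisym list_emb_length subseq_same_length)
qed

section \<open>Universality\<close>

definition universal :: "'a set \<Rightarrow> nat \<Rightarrow> 'a list \<Rightarrow> bool" where
  "universal S l w \<longleftrightarrow> (\<forall>u \<in> lists S. length u \<le> l \<longrightarrow> subseq u w)"

lemma universalD: "universal S l w \<Longrightarrow> u \<in> lists S \<Longrightarrow> length u \<le> l \<Longrightarrow> subseq u w"
  by (simp add: universal_def)

lemma universal_0: "universal S 0 w"
  by (simp add: universal_def)

lemma universal_append:
  assumes "universal S i u" "universal S j v"
  shows "universal S (i + j) (u @ v)"
  unfolding universal_def
proof (intro ballI impI)
  fix x assume x: "x \<in> lists S" "length x \<le> i + j"
  then have "subseq (take i x) u" "subseq (drop i x) v"
    by (auto intro!: universalD[OF assms(1)] universalD[OF assms(2)]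
        dest: in_set_takeD in_set_dropD)
  then show "subseq x (u @ v)"
    using list_emb_append_mono[of _ "take i x" u "drop i x" v] by simp
qed

lemma universal_arch:
  assumes "is_arch S u"
  shows "universal S 1 u"
  unfolding universal_def
proof (intro ballI impI)
  fix x assume "x \<in> lists S" "length x \<le> 1"
  then show "subseq x u"
    using assms by (cases x) (auto simp: is_arch_def subseq_singleton_left)
qed

lemma universal_rev: "universal S l (rev w) \<longleftrightarrow> universal S l w"
proof -
  have "universal S l (rev w)" if "universal S l w" for w :: "'a list"
    unfolding universal_def
  proof (intro ballI impI)
    fix u assume "u \<in> lists S" "length u \<le> l"
    then have "subseq (rev u) w"
      by (intro universalD[OF that]) auto
    then show "subseq u (rev w)"
      by (metis rev_rev_ident subseq_rev)
  qed
  from this[of w] this[of "rev w"] show ?thesis by auto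
qed

lemma iota_eqI:
  assumes "universal S l w" "q \<in> lists S" "length q = Suc l" "\<not> subseq q w"
  shows "iota S w = l"
  unfolding iota_def
proof (rule Greatest_equality)
  show "\<forall>u\<in>lists S. length u = l \<longrightarrow> subseq u w"
    using assms(1) by (simp add: universal_def)
next
  fix y assume y: "\<forall>u\<in>lists S. length u = y \<longrightarrow> subseq u w"
  show "y \<le> l"
  proof (rule ccontr)
    assume "\<not> y \<le> l"
    \<comment> \<open>A missing word stays missing when padded; \<open>hd q\<close> is a letter of
      \<open>S\<close> because \<open>q\<close> is nonempty.\<close>
    then have "length (q @ replicate (y - Suc l) (hd q)) = y"
      using assms(3) by simp
    moreover have "q @ replicate (y - Suc l) (hd q) \<in> lists S"
      using assms(2,3) by (cases q) auto
    ultimately have "subseq (q @ replicate (y - Suc l) (hd q)) w"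
      using y by blast
    then show False
      using assms(4) by (meson prefixI prefix_imp_subseq subseq_order.trans)
  qed
qed

section \<open>The alpha-beta-factorization and its universality\<close>

text \<open>
  \<open>ab_fact S \<alpha>\<^sub>0 [(\<beta>\<^sub>1, \<alpha>\<^sub>1), \<dots>, (\<beta>\<^sub>l, \<alpha>\<^sub>l)]\<close> is the \<open>\<alpha>\<close>-\<open>\<beta>\<close>-factorization without
  reference to the definite descriptions \<open>ar\<close>, \<open>ra\<close>, \<open>er\<close>, \<open>re\<close>.
\<close>

inductive ab_fact :: "'a set \<Rightarrow> 'a list \<Rightarrow> ('a list \<times> 'a list) list \<Rightarrow> bool" for S where
  Nil: "\<not> S \<subseteq> set \<alpha> \<Longrightarrow> ab_fact S \<alpha> []"
| Cons: "ab_fact S \<alpha>' bs \<Longrightarrow> is_arch S (\<alpha> @ \<beta>) \<Longrightarrow> is_arch S (rev (\<beta> @ \<alpha>')) \<Longrightarrow>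
    ab_fact S \<alpha> ((\<beta>, \<alpha>') # bs)"

inductive_cases ab_fact_ConsE: "ab_fact S \<alpha> ((\<beta>, \<alpha>') # bs)"

definition ab_word :: "'a list \<Rightarrow> ('a list \<times> 'a list) list \<Rightarrow> 'a list" where
  "ab_word \<alpha> bs = \<alpha> @ concat (map (\<lambda>(\<beta>, \<gamma>). \<beta> @ \<gamma>) bs)"

lemma ab_word_Nil [simp]: "ab_word \<alpha> [] = \<alpha>"
  by (simp add: ab_word_def)

lemma ab_word_Cons [simp]: "ab_word \<alpha> ((\<beta>, \<gamma>) # bs) = \<alpha> @ \<beta> @ ab_word \<gamma> bs"
  by (simp add: ab_word_def)

text \<open>An empty \<open>\<beta>\<close> would make \<open>rev \<alpha>'\<close> an arch, against
  the induction hypothesis. So \<open>\<beta>\<close> contains the last letter of the arch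
  \<open>\<alpha> @ \<beta>\<close>, and \<open>\<alpha>\<close> lacks it.\<close>

lemma ab_fact_not_full:
  assumes "ab_fact S \<alpha> bs"
  shows "\<not> S \<subseteq> set \<alpha>"
  using assms
proof induction
  case (Cons \<alpha>' bs \<alpha> \<beta>)
  show ?case
  proof (cases \<beta> rule: rev_cases)
    case Nil
    then show ?thesis using Cons by (simp add: is_arch_def)
  next
    case (snoc s y)
    then show ?thesis using Cons.hyps(2) by (auto simp: is_arch_altdef)
  qed
qed

text \<open>Each \<open>\<beta> @ \<alpha>'\<close> is a reversed arch and provides any one letter.
  The initial \<open>\<alpha>\<close> is left out so that it remains free for reading another
  word.\<close>

lemma ab_fact_universal_suffix:
  assumes "ab_fact S \<alpha> bs"
  shows "universal S (length bs) (concat (map (\<lambda>(\<beta>, \<gamma>). \<beta> @ \<gamma>) bs))"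
  using assms
proof induction
  case (Cons \<alpha>' bs \<alpha> \<beta>)
  then have "universal S 1 (\<beta> @ \<alpha>')"
    using universal_arch universal_rev by blast
  from universal_append[OF this Cons.IH] show ?case by simp
qed (simp add: universal_0)

lemma ab_fact_universal:
  assumes "ab_fact S \<alpha> bs"
  shows "universal S (length bs) (ab_word \<alpha> bs)"
  using universal_append[OF universal_0 ab_fact_universal_suffix[OF assms]]
  by (simp add: ab_word_def)

text \<open>The word \<open>q\<close> consists of the first letters of the reversed arches.\<close>

lemma ab_fact_suffix_forcing:
  assumes "ab_fact S \<alpha> bs"
  shows "\<exists>q \<in> lists S. length q = length bs \<and>
    (\<forall>z u. subseq (u @ q) (z @ ab_word \<alpha> bs) \<longrightarrow> subseq u (z @ \<alpha>))"
  using assms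
proof induction
  case (Nil \<alpha>)
  show ?case by (intro bexI[of _ "[]"]) auto
next
  case (Cons \<alpha>' bs \<alpha> \<beta>)
  then obtain q where q: "q \<in> lists S" "length q = length bs"
    "\<And>z u. subseq (u @ q) (z @ ab_word \<alpha>' bs) \<Longrightarrow> subseq u (z @ \<alpha>')"
    by blast
  obtain v c where vc: "rev (\<beta> @ \<alpha>') = v @ [c]" "c \<notin> set v" "S = insert c (set v)"
    using Cons.hyps(3) by (auto simp: is_arch_altdef)
  then have eq: "\<beta> @ \<alpha>' = c # rev v"
    by (metis rev_rev_ident rev_eq_Cons_iff)
  have "subseq u (z @ \<alpha>)" if "subseq (u @ c # q) (z @ ab_word \<alpha> ((\<beta>, \<alpha>') # bs))" for z u
  proof -
    have "subseq ((u @ [c]) @ q) ((z @ \<alpha> @ \<beta>) @ ab_word \<alpha>' bs)"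
      using that by simp
    then have "subseq (u @ [c]) ((z @ \<alpha> @ \<beta>) @ \<alpha>')"
      by (rule q(3))
    then have "subseq (u @ [c]) ((z @ \<alpha>) @ c # rev v)"
      using eq by simp
    then show ?thesis
      by (rule subseq_append_Cons_notin) (use vc in simp)
  qed
  then show ?case
    using q vc by (intro bexI[of _ "c # q"]) auto
qed

text \<open>A letter missing from \<open>\<alpha>\<close>, put in front of the forcing word, would
  have to be read inside \<open>\<alpha>\<close>.\<close>

lemma ab_fact_absent_word:
  assumes "ab_fact S \<alpha> bs"
  shows "\<exists>q \<in> lists S. length q = Suc (length bs) \<and> \<not> subseq q (ab_word \<alpha> bs)"
proof -
  obtain q where q: "q \<in> lists S" "length q = length bs"
    "\<And>z u. subseq (u @ q) (z @ ab_word \<alpha> bs) \<Longrightarrow> subseq u (z @ \<alpha>)"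
    using ab_fact_suffix_forcing[OF assms] by blast
  obtain c where c: "c \<in> S" "c \<notin> set \<alpha>"
    using ab_fact_not_full[OF assms] by blast
  have "\<not> subseq (c # q) (ab_word \<alpha> bs)"
    using q(3)[of "[c]" "[]"] c by (auto simp: subseq_singleton_left)
  then show ?thesis
    using q c by (intro bexI[of _ "c # q"]) auto
qed

lemma iota_ab_word:
  assumes "ab_fact S \<alpha> bs"
  shows "iota S (ab_word \<alpha> bs) = length bs"
  using ab_fact_absent_word[OF assms] ab_fact_universal[OF assms] iota_eqI by blast

text \<open>The factorization is built from the right: read backwards, \<open>u @ \<alpha>'\<close>
  starts with an arch \<open>e\<close>, whose end marks where \<open>u\<close> splits into
  \<open>\<alpha>\<close> and \<open>\<beta>\<close>.\<close>

lemma arches_imp_ab_fact: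
  assumes "\<forall>u \<in> set us. is_arch S u" "\<not> S \<subseteq> set r" "set r \<subseteq> S"
  shows "\<exists>\<alpha> bs. ab_fact S \<alpha> bs \<and> concat us @ r = ab_word \<alpha> bs \<and> length bs = length us"
  using assms(1)
proof (induction us)
  case Nil
  then show ?case using assms by (intro exI[of _ r] exI[of _ "[]"]) (auto intro: ab_fact.Nil)
next
  case (Cons u us)
  then obtain \<alpha>' bs where ab: "ab_fact S \<alpha>' bs" "concat us @ r = ab_word \<alpha>' bs"
    "length bs = length us"
    by auto
  have "set (concat us @ r) \<subseteq> S"
    using Cons.prems assms(3) by (auto simp: is_arch_def)
  then have "set \<alpha>' \<subseteq> S"
    by (simp only: ab(2)) (simp add: ab_word_def)
  moreover have u: "is_arch S u" "set u = S"
    using Cons.prems by (auto simp: is_arch_def)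
  moreover have "S \<noteq> {}" using assms(2) by blast
  ultimately obtain e f where ef: "rev (u @ \<alpha>') = e @ f" "is_arch S e"
    using is_arch_prefix_exists[of "rev (u @ \<alpha>')" S] by fastforce
  \<comment> \<open>The arch \<open>e\<close> reaches beyond \<open>rev \<alpha>'\<close>, which
    lacks a letter of \<open>S\<close>.\<close>
  have "\<exists>g. e = rev \<alpha>' @ g \<and> rev u = g @ f"
  proof -
    have "rev \<alpha>' @ rev u = e @ f" using ef by simp
    then obtain d where "rev \<alpha>' = e @ d \<or> e = rev \<alpha>' @ d \<and> rev u = d @ f"
      by (auto simp: append_eq_append_conv2)
    moreover have "rev \<alpha>' \<noteq> e @ d"
    proof
      assume "rev \<alpha>' = e @ d"
      then have "set e \<subseteq> set \<alpha>'" by (metis set_append set_rev Un_upper1)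
      then show False
        using ab_fact_not_full[OF ab(1)] ef(2) by (simp add: is_arch_def)
    qed
    ultimately show ?thesis by blast
  qed
  then obtain g where g: "e = rev \<alpha>' @ g" "rev u = g @ f" by blast
  then have u_eq: "u = rev f @ rev g"
    by (metis rev_append rev_rev_ident)
  have "ab_fact S (rev f) ((rev g, \<alpha>') # bs)"
    using ab(1) u(1) ef(2) g(1) u_eq by (intro ab_fact.Cons) auto
  then show ?case
    using ab(2,3) u_eq by (intro exI[of _ "rev f"] exI[of _ "(rev g, \<alpha>') # bs"]) auto
qed

lemma iota_arch_fact:
  assumes "w \<in> lists S" "is_arch_fact S w us r"
  shows "iota S w = length us"
proof -
  have "\<forall>u \<in> set us. is_arch S u" "\<not> S \<subseteq> set r" "set r \<subseteq> S" "w = concat us @ r"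
    using assms by (auto simp: is_arch_fact_def)
  with arches_imp_ab_fact[of us S r] show ?thesis
    using iota_ab_word by metis
qed

lemma ab_fact_exists:
  assumes "w \<in> lists S" "S \<noteq> {}"
  shows "\<exists>\<alpha> bs. ab_fact S \<alpha> bs \<and> w = ab_word \<alpha> bs"
proof -
  obtain us r where "is_arch_fact S w us r"
    using is_arch_fact_exists[OF assms] by blast
  then have "\<forall>u \<in> set us. is_arch S u" "\<not> S \<subseteq> set r" "set r \<subseteq> S" "w = concat us @ r"
    using assms by (auto simp: is_arch_fact_def)
  with arches_imp_ab_fact[of us S r] show ?thesis by metis
qed

text \<open>\<open>ra\<close> selects arches of \<open>rev w\<close> by an index computed from
  \<open>iota S w\<close>; this keeps the index in range. Universality and absent words both survive
  reversal.\<close>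

lemma iota_rev:
  assumes "w \<in> lists S" "S \<noteq> {}"
  shows "iota S (rev w) = iota S w"
proof -
  obtain \<alpha> bs where ab: "ab_fact S \<alpha> bs" "w = ab_word \<alpha> bs"
    using ab_fact_exists[OF assms] by blast
  obtain q where q: "q \<in> lists S" "length q = Suc (length bs)" "\<not> subseq q w"
    using ab_fact_absent_word[OF ab(1)] ab(2) by blast
  have "iota S (rev w) = length bs"
  proof (rule iota_eqI)
    show "universal S (length bs) (rev w)"
      using ab_fact_universal[OF ab(1)] ab(2) universal_rev by blast
    show "rev q \<in> lists S" "length (rev q) = Suc (length bs)" using q by auto
    show "\<not> subseq (rev q) (rev w)" using q(3) by (simp add: subseq_rev)
  qed
  then show ?thesis using iota_ab_word[OF ab(1)] ab(2) by simp
qed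

lemma alpha_beta_fact_imp_ab_fact:
  assumes "w \<in> lists S" "S \<noteq> {}" "alpha_beta_fact S w \<alpha> \<beta>"
  shows "ab_fact S (\<alpha> 0) (map (\<lambda>i. (\<beta> i, \<alpha> i)) [1..<iota S w + 1])"
proof -
  have arch: "is_arch S (ar S i v)" if v: "v \<in> lists S" and i: "i \<in> {1..iota S v}" for i v
  proof -
    have f: "is_arch_fact S v (fst (arch_fact S v)) (snd (arch_fact S v))"
      by (rule is_arch_fact_arch_fact[OF v assms(2)])
    then have "i - 1 < length (fst (arch_fact S v))"
      using iota_arch_fact[OF v f] i by auto
    then show ?thesis
      using f by (simp add: is_arch_fact_def ar_def)
  qed
  have arches: "is_arch S (\<alpha> (i - 1) @ \<beta> i) \<and> is_arch S (rev (\<beta> i @ \<alpha> i))"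
    if i: "i \<in> {1..iota S w}" for i
  proof -
    have "iota S w - i + 1 \<in> {1..iota S (rev w)}"
      using i iota_rev[OF assms(1,2)] by auto
    then have "is_arch S (rev (ra S i w))"
      unfolding ra_def rev_rev_ident by (rule arch[rotated]) (use assms(1) in auto)
    then show ?thesis
      using arch[OF assms(1) i] assms(3) i by (simp add: alpha_beta_fact_def)
  qed
  have last: "\<not> S \<subseteq> set (\<alpha> (iota S w))"
    using is_arch_fact_arch_fact[OF assms(1,2)] assms(3)
    by (simp add: alpha_beta_fact_def re_def is_arch_fact_def)
  \<comment> \<open>Downward induction on \<open>j\<close>, since \<open>ab_fact\<close> grows at
    the front.\<close>
  have "ab_fact S (\<alpha> j) (map (\<lambda>i. (\<beta> i, \<alpha> i)) [j + 1..<iota S w + 1])"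
    if "j \<le> iota S w" for j
    using that
  proof (induction rule: inc_induct)
    case base
    then show ?case using last by (simp add: ab_fact.Nil)
  next
    case (step n)
    have "[n + 1..<iota S w + 1] = Suc n # [Suc n + 1..<iota S w + 1]"
      using step.hyps by (simp add: upt_rec)
    then show ?case
      using step.IH step.hyps arches[of "Suc n"]
      by (auto intro: ab_fact.Cons)
  qed
  from this[of 0] show ?thesis by simp
qed

section \<open>Cancelling arches in congruent words\<close>

text \<open>The last letter \<open>c\<close> of the arch \<open>v\<close> occurs in \<open>u\<close>
  but nowhere earlier in \<open>v\<close>. Prefixing \<open>c\<close> to a word forces the rest past
  \<open>v\<close>, at the cost of one level.\<close>

lemma simon_cong_strip_arch:
  assumes "is_arch S u" "is_arch S v" "simon_cong (Suc k) (u @ x) (v @ y)"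
  shows "simon_cong k x y"
proof -
  have "subseq z y"
    if h: "is_arch S u" "is_arch S v" "simon_cong (Suc k) (u @ x) (v @ y)"
      "subseq z x" "length z \<le> k" for u v x y z :: "'a list"
  proof -
    obtain p c where v: "v = p @ [c]" "c \<notin> set p" "c \<in> S"
      using h(2) by (auto simp: is_arch_altdef)
    have "subseq [c] u"
      using h(1) v(3) by (simp add: is_arch_def subseq_singleton_left)
    from list_emb_append_mono[OF this h(4)] have "subseq (c # z) (u @ x)" by simp
    then have "subseq (c # z) (v @ y)"
      using simon_congD[OF h(3)] h(5) by simp
    then show ?thesis
      using subseq_Cons_append_notin[of c z p y] v by simp
  qed
  from this[of u v x y] this[of v u y x] show ?thesis
    using assms simon_cong_sym by (auto simp: simon_cong_iff)
qed

text \<open>Appending the forcing word of the other factorization costs \<open>length bs\<close>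
  levels. Empty prefixes \<open>z\<close>, \<open>z'\<close> serve to compare factors
  \<open>\<alpha>\<close>, prefixes of the form \<open>\<alpha> @ \<beta>\<close> to compare whole
  blocks.\<close>

lemma simon_cong_strip_suffix:
  assumes "ab_fact S \<alpha> bs" "ab_fact S \<alpha>' bs'" "length bs = length bs'"
    and "simon_cong (k + length bs) (z @ ab_word \<alpha> bs) (z' @ ab_word \<alpha>' bs')"
  shows "simon_cong k (z @ \<alpha>) (z' @ \<alpha>')"
proof -
  have "subseq u (z' @ \<alpha>')"
    if h: "ab_fact S \<alpha> bs" "ab_fact S \<alpha>' bs'" "length bs = length bs'"
      "simon_cong (k + length bs) (z @ ab_word \<alpha> bs) (z' @ ab_word \<alpha>' bs')"
      "subseq u (z @ \<alpha>)" "length u \<le> k" for \<alpha> \<alpha>' bs bs' z z' and u :: "'a list"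
  proof -
    obtain q where q: "q \<in> lists S" "length q = length bs'"
      "\<And>z u. subseq (u @ q) (z @ ab_word \<alpha>' bs') \<Longrightarrow> subseq u (z @ \<alpha>')"
      using ab_fact_suffix_forcing[OF h(2)] by blast
    have "subseq q (concat (map (\<lambda>(\<beta>, \<gamma>). \<beta> @ \<gamma>) bs))"
      using universalD[OF ab_fact_universal_suffix[OF h(1)] q(1)] q(2) h(3) by simp
    from list_emb_append_mono[OF h(5) this]
    have "subseq (u @ q) (z @ ab_word \<alpha> bs)" by (simp add: ab_word_def)
    then show ?thesis
      using simon_congD[OF h(4)] h(3,6) q(2,3) by simp
  qed
  from this[of \<alpha> bs \<alpha>' bs' z z'] this[of \<alpha>' bs' \<alpha> bs z' z] show ?thesis
    using assms simon_cong_sym by (auto simp: simon_cong_iff)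
qed

text \<open>A shortest absent word of the side with fewer blocks has length at most
  \<open>k\<close>, and it occurs in the other side by universality.\<close>

lemma simon_cong_length_eq:
  assumes "ab_fact S \<alpha> bs" "ab_fact S \<alpha>' bs'"
    and "simon_cong k (ab_word \<alpha> bs) (ab_word \<alpha>' bs')" "length bs < k"
  shows "length bs = length bs'"
proof (rule ccontr)
  assume ne: "length bs \<noteq> length bs'"
  obtain q where q: "q \<in> lists S" "length q = Suc (length bs)" "\<not> subseq q (ab_word \<alpha> bs)"
    using ab_fact_absent_word[OF assms(1)] by blast
  obtain q' where q': "q' \<in> lists S" "length q' = Suc (length bs')"
    "\<not> subseq q' (ab_word \<alpha>' bs')"
    using ab_fact_absent_word[OF assms(2)] by blast
  show False
  proof (cases "length bs < length bs'")
    case True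
    then have "subseq q (ab_word \<alpha>' bs')"
      using universalD[OF ab_fact_universal[OF assms(2)] q(1)] q(2) by simp
    then show False using simon_congD[OF simon_cong_sym[OF assms(3)]] q assms(4) by auto
  next
    case False
    then have "subseq q' (ab_word \<alpha> bs)"
      using universalD[OF ab_fact_universal[OF assms(1)] q'(1)] q'(2) ne by simp
    then show False using simon_congD[OF assms(3)] q' assms(4) ne False by auto
  qed
qed

section \<open>Uniqueness over a binary alphabet\<close>

text \<open>The last letter of \<open>\<beta>\<close> occurs neither in \<open>\<alpha>\<close> nor
  elsewhere in \<open>\<beta>\<close>, the first neither elsewhere in \<open>\<beta>\<close> nor in
  \<open>\<gamma>\<close>. With two letters this leaves no room between them.\<close>

lemma binary_core_cases:
  assumes "a \<noteq> b" "is_arch {a, b} (\<alpha> @ \<beta>)" "is_arch {a, b} (rev (\<beta> @ \<gamma>))"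
    and "\<not> {a, b} \<subseteq> set \<alpha>"
  shows "\<beta> = [a] \<and> set \<alpha> = {b} \<and> set \<gamma> = {b} \<or> \<beta> = [b] \<and> set \<alpha> = {a} \<and> set \<gamma> = {a} \<or>
    \<beta> = [a, b] \<and> set \<alpha> \<subseteq> {a} \<and> set \<gamma> \<subseteq> {b} \<or> \<beta> = [b, a] \<and> set \<alpha> \<subseteq> {b} \<and> set \<gamma> \<subseteq> {a}"
proof (cases \<beta> rule: rev_cases)
  case Nil
  then show ?thesis using assms by (simp add: is_arch_def)
next
  case (snoc s y)
  then have y: "y \<in> {a, b}" "set \<alpha> \<union> set s = {a, b} - {y}"
    using assms(2) by (auto simp: is_arch_altdef)
  show ?thesis
  proof (cases s)
    case Nil
    then have "set \<gamma> = {a, b} - {y}"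
      using assms(3) snoc by (auto simp: is_arch_altdef)
    moreover have "set \<alpha> = {a, b} - {y}" using y(2) Nil by simp
    ultimately show ?thesis
      using y(1) Nil snoc assms(1) by (elim insertE emptyE) (simp_all add: insert_Diff_if)
  next
    case (Cons x t)
    then have x: "x \<in> {a, b}" "x \<noteq> y" "set t \<union> set \<gamma> \<subseteq> {a, b} - {x}"
      using assms(3) snoc y(2) by (auto simp: is_arch_altdef)
    have "set t \<subseteq> {a, b} - {x} - {y}" using x(3) y(2) Cons by auto
    also have "\<dots> = {}" using x(1,2) y(1) by auto
    finally have "t = []" by simp
    moreover have "set \<alpha> \<subseteq> {a, b} - {y}" using y(2) by blast
    ultimately show ?thesis
      using x y(1) Cons snoc assms(1) by (elim insertE emptyE) (simp_all add: insert_Diff_if)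
  qed
qed

text \<open>\<open>\<alpha>\<close> and \<open>\<gamma>\<close> determine \<open>\<beta>\<close>
  unless both are empty; then \<open>[a, b]\<close> and \<open>[b, a]\<close> remain, which level 2
  tells apart.\<close>

lemma binary_core_unique:
  assumes "a \<noteq> b" "is_arch {a, b} (\<alpha> @ \<beta>)" "is_arch {a, b} (rev (\<beta> @ \<gamma>))"
    and "is_arch {a, b} (\<alpha> @ \<beta>')" "is_arch {a, b} (rev (\<beta>' @ \<gamma>))" "\<not> {a, b} \<subseteq> set \<alpha>"
    and "simon_cong k (\<alpha> @ \<beta> @ \<gamma>) (\<alpha> @ \<beta>' @ \<gamma>)" "k \<ge> 2"
  shows "\<beta> = \<beta>'"
proof -
  have "\<not> simon_cong k [a, b] [b, a]" "\<not> simon_cong k [b, a] [a, b]"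
    using assms(1,8) by (auto simp: simon_cong_iff intro!: exI[of _ "[a, b]"])
  then have "\<not> (\<alpha> = [] \<and> \<gamma> = [] \<and> (\<beta> = [a, b] \<and> \<beta>' = [b, a] \<or> \<beta> = [b, a] \<and> \<beta>' = [a, b]))"
    using assms(7) by auto
  moreover have "xs = []" if "set xs \<subseteq> {a}" "set xs \<subseteq> {b}" for xs
    using that assms(1) by (cases xs) auto
  ultimately show ?thesis
    using binary_core_cases[OF assms(1,2,3,6)] binary_core_cases[OF assms(1,4,5,6)] assms(1)
    by auto
qed

lemma binary_ab_fact_unique:
  assumes "a \<noteq> b" "ab_fact {a, b} \<alpha> bs" "ab_fact {a, b} \<alpha>' bs'"
    and "length bs = length bs'" "\<forall>\<gamma> \<in> insert \<alpha> (snd ` set bs). length \<gamma> < d"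
    and "simon_cong (d + length bs) (ab_word \<alpha> bs) (ab_word \<alpha>' bs')"
  shows "\<alpha> = \<alpha>' \<and> bs = bs'"
  using assms(2-)
proof (induction bs arbitrary: \<alpha> \<alpha>' bs' rule: list.induct)
  case Nil
  then show ?case using simon_cong_short_eq[of d \<alpha> \<alpha>'] by simp
next
  case (Cons p bs)
  obtain \<beta> \<gamma> where p: "p = (\<beta>, \<gamma>)" by fastforce
  obtain \<beta>' \<gamma>' cs where bs': "bs' = (\<beta>', \<gamma>') # cs"
    using Cons.prems(3) by (cases bs') auto
  have f: "ab_fact {a, b} \<gamma> bs" "is_arch {a, b} (\<alpha> @ \<beta>)" "is_arch {a, b} (rev (\<beta> @ \<gamma>))"
    using Cons.prems(1) unfolding p by (auto elim: ab_fact_ConsE)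
  have f': "ab_fact {a, b} \<gamma>' cs" "is_arch {a, b} (\<alpha>' @ \<beta>')" "is_arch {a, b} (rev (\<beta>' @ \<gamma>'))"
    using Cons.prems(2) unfolding bs' by (auto elim: ab_fact_ConsE)
  have len: "length bs = length cs" using Cons.prems(3) bs' by simp
  have cong: "simon_cong (Suc (d + length bs)) ((\<alpha> @ \<beta>) @ ab_word \<gamma> bs) ((\<alpha>' @ \<beta>') @ ab_word \<gamma>' cs)"
    using Cons.prems(5) p bs' by simp
  \<comment> \<open>Stripping an arch lowers the level and \<open>length bs\<close> by one each, so
    \<open>d\<close> stays fixed in the induction.\<close>
  have tail: "\<gamma> = \<gamma>' \<and> bs = cs"
    using simon_cong_strip_arch[OF f(2) f'(2) cong] f(1) f'(1) len Cons.prems(4) p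
    by (intro Cons.IH) auto
  have "simon_cong d \<alpha> \<alpha>'"
    using simon_cong_strip_suffix[OF Cons.prems(1,2,3), of d "[]" "[]"] Cons.prems(5) by simp
  then have \<alpha>: "\<alpha> = \<alpha>'"
    using simon_cong_short_eq Cons.prems(4) by auto
  have "simon_cong (Suc d) ((\<alpha> @ \<beta>) @ \<gamma>) ((\<alpha>' @ \<beta>') @ \<gamma>')"
    using simon_cong_strip_suffix[OF f(1) f'(1) len, of "Suc d" "\<alpha> @ \<beta>" "\<alpha>' @ \<beta>'"] cong by simp
  \<comment> \<open>The strict bound on \<open>length \<alpha>\<close> makes \<open>d\<close>
    positive.\<close>
  moreover have "Suc d \<ge> 2" using Cons.prems(4) by auto
  ultimately have "\<beta> = \<beta>'"
    using binary_core_unique[OF assms(1), of \<alpha> \<beta> \<gamma> \<beta>' "Suc d"] f f' \<alpha> tail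
      ab_fact_not_full[OF Cons.prems(1)] by simp
  then show ?case using \<alpha> tail p bs' by simp
qed

section \<open>Pumping and infinite classes\<close>

lemma subseq_pump:
  assumes "universal S i p" "universal S j q" "length u \<le> i + m + j" "u \<in> lists S"
    and "subseq u (p @ replicate (m + n) x @ q)"
  shows "subseq u (p @ replicate m x @ q)"
proof -
  obtain u1 u23 where u1: "u = u1 @ u23" "subseq u1 p" "subseq u23 (replicate (m + n) x @ q)"
    using assms(5) by (auto simp: subseq_append_iff)
  obtain u2 u3 where u3: "u23 = u2 @ u3" "subseq u2 (replicate (m + n) x)" "subseq u3 q"
    using u1(3) by (auto simp: subseq_append_iff)
  obtain h where u2: "u2 = replicate h x"
    using subseq_imp_subset[OF u3(2)] replicate_length_same[of u2 x]
    by (metis in_set_replicate subsetD)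
  \<comment> \<open>Enlarging the parts of \<open>u\<close> read in \<open>p\<close> and \<open>q\<close> to lengths \<open>i\<close> and \<open>j\<close> leaves at most \<open>m\<close>
    letters for the middle.\<close>
  define s where "s = max i (length u1)"
  define t where "t = max j (length u3)"
  have sub: "take c u \<in> lists S" "drop c u \<in> lists S" for c
    using assms(4) by (auto dest: in_set_takeD in_set_dropD)
  have s: "subseq (take s u) p"
  proof (cases "i \<le> length u1")
    case True
    then show ?thesis using u1 by (simp add: s_def max_def)
  next
    case False
    then show ?thesis using universalD[OF assms(1) sub(1)] by (simp add: s_def)
  qed
  have t: "subseq (drop (length u - t) u) q"
  proof (cases "j \<le> length u3")
    case True
    then show ?thesis using u1 u3 by (simp add: t_def max_def)
  next
    case False
    then show ?thesis using universalD[OF assms(2) sub(2)] by (simp add: t_def)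
  qed
  show ?thesis
  proof (cases "length u \<le> s + t")
    case True
    \<comment> \<open>The prefix of length \<open>s\<close> and the suffix of length
      \<open>t\<close> cover \<open>u\<close>, so what follows the prefix lies in that
      suffix.\<close>
    then have "drop s u = drop (s - (length u - t)) (drop (length u - t) u)"
      by simp
    then have "subseq (drop s u) q"
      using t by (metis subseq_order.trans suffix_drop suffix_imp_subseq)
    then have "subseq (drop s u) (replicate m x @ q)"
      by (simp add: list_emb_append2)
    from list_emb_append_mono[OF s this] show ?thesis by simp
  next
    case False
    have "drop s u = drop (s - length u1) (u2 @ u3)"
      using u1 u3 by (simp add: s_def)
    \<comment> \<open>As \<open>s \<ge> length u1\<close> and \<open>t \<ge> length u3\<close>, the
      uncovered letters all come from \<open>u2\<close>.\<close>
    then have mid: "take (length u - s - t) (drop s u) = replicate (length u - s - t) x"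
      using False u1 u2 u3 by (auto simp: s_def t_def min_def)
    have "length u - s - t \<le> m"
      using assms(3) by (auto simp: s_def t_def)
    then have "subseq (replicate (length u - s - t) x) (replicate m x)"
      by (metis le_add_diff_inverse replicate_add prefix_imp_subseq prefixI)
    moreover have "drop s u = take (length u - s - t) (drop s u) @ drop (length u - t) u"
    proof -
      have "drop (length u - t) u = drop (length u - s - t) (drop s u)"
        using False by simp
      then show ?thesis by (simp only: append_take_drop_id)
    qed
    ultimately have "subseq (drop s u) (replicate m x @ q)"
      using mid t list_emb_append_mono by metis
    from list_emb_append_mono[OF s this] show ?thesis by simp
  qed
qed

lemma infinite_simon_class_pump:
  assumes "universal S i p" "universal S j q" "k \<le> i + m + j" "x \<in> S" "p \<in> lists S" "q \<in> lists S"
  shows "infinite (simon_class S k (p @ replicate m x @ q))"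
proof -
  define f where "f n = p @ replicate (m + n) x @ q" for n
  have "f n \<in> simon_class S k (f 0)" for n
  proof -
    have lists: "f n \<in> lists S" for n
      using assms(4-6) by (auto simp: f_def)
    have "subseq u (f n) \<longleftrightarrow> subseq u (f 0)" if "length u \<le> k" for u
    proof
      assume "subseq u (f 0)"
      moreover have "subseq (f 0) (f n)"
        unfolding f_def replicate_add append_assoc add_0_right
        by (intro list_emb_append_mono list_emb_append2 subseq_order.refl)
      ultimately show "subseq u (f n)" by (rule subseq_order.trans)
    next
      assume u: "subseq u (f n)"
      then have "u \<in> lists S"
        using lists[of n] subseq_imp_subset by blast
      then show "subseq u (f 0)"
        using subseq_pump[OF assms(1,2), of u m n x] u that assms(3) by (simp add: f_def)
    qed
    then show ?thesis
      using lists by (simp add: simon_class_def simon_cong_iff)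
  qed
  then have "range f \<subseteq> simon_class S k (f 0)" by blast
  moreover have "inj f"
    by (rule injI) (auto simp: f_def dest: arg_cong[of _ _ length])
  then have "infinite (range f)"
    using finite_imageD by blast
  ultimately have "infinite (simon_class S k (f 0))"
    using finite_subset by blast
  then show ?thesis by (simp add: f_def)
qed

text \<open>Left of \<open>\<gamma>\<close> stand \<open>i\<close> arches, right of it
  \<open>j\<close> reversed arches.\<close>

lemma ab_fact_split_at_alpha:
  assumes "ab_fact S \<alpha> bs" "\<gamma> \<in> insert \<alpha> (snd ` set bs)"
  shows "\<exists>p q i j. ab_word \<alpha> bs = p @ \<gamma> @ q \<and> universal S i p \<and> universal S j q \<and>
    i + j = length bs \<and> \<not> S \<subseteq> set \<gamma>"
  using assms
proof (induction)
  case (Nil \<alpha>)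
  then show ?case
    using universal_0 by (intro exI[of _ "[]"] exI[of _ "0::nat"]) auto
next
  case (Cons \<alpha>' bs \<alpha> \<beta>)
  note ab = ab_fact.Cons[OF Cons.hyps]
  show ?case
  proof (cases "\<gamma> = \<alpha>")
    case True
    then show ?thesis
      using ab_fact_universal_suffix[OF ab] universal_0[of S "[]"] ab_fact_not_full[OF ab]
      by (intro exI[of _ "[]"] exI[of _ "concat (map (\<lambda>(\<beta>, \<gamma>). \<beta> @ \<gamma>) ((\<beta>, \<alpha>') # bs))"]
          exI[of _ "0::nat"] exI[of _ "length ((\<beta>, \<alpha>') # bs)"]) (auto simp: ab_word_def)
  next
    case False
    then have "\<gamma> \<in> insert \<alpha>' (snd ` set bs)" using Cons.prems by auto
    then obtain p q i j where *: "ab_word \<alpha>' bs = p @ \<gamma> @ q" "universal S i p"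
      "universal S j q" "i + j = length bs" "\<not> S \<subseteq> set \<gamma>"
      using Cons.IH by blast
    have "universal S (1 + i) ((\<alpha> @ \<beta>) @ p)"
      using universal_append universal_arch Cons.hyps(2) *(2) by blast
    then show ?thesis
      using * by (intro exI[of _ "(\<alpha> @ \<beta>) @ p"] exI[of _ q] exI[of _ "1 + i"] exI[of _ j]) auto
  qed
qed

lemma binary_infinite_simon_class:
  assumes "a \<noteq> b" "ab_fact {a, b} \<alpha> bs" "ab_word \<alpha> bs \<in> lists {a, b}"
    and "k \<le> length bs \<or> (\<exists>\<gamma> \<in> insert \<alpha> (snd ` set bs). k \<le> length bs + length \<gamma>)"
  shows "infinite (simon_class {a, b} k (ab_word \<alpha> bs))"
  using assms(4)
proof
  assume "k \<le> length bs"
  \<comment> \<open>The whole word is already universal enough, so an empty power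
    (\<open>m = 0\<close>) at its end can be pumped.\<close>
  then show ?thesis
    using infinite_simon_class_pump[of "{a, b}" "length bs" "ab_word \<alpha> bs" 0 "[]" k 0 a]
      ab_fact_universal[OF assms(2)] universal_0[of "{a, b}" "[]"] assms(3) by simp
next
  assume "\<exists>\<gamma> \<in> insert \<alpha> (snd ` set bs). k \<le> length bs + length \<gamma>"
  then obtain \<gamma> where \<gamma>: "\<gamma> \<in> insert \<alpha> (snd ` set bs)" "k \<le> length bs + length \<gamma>" by blast
  obtain p q i j where *: "ab_word \<alpha> bs = p @ \<gamma> @ q" "universal {a, b} i p"
      "universal {a, b} j q" "i + j = length bs" "\<not> {a, b} \<subseteq> set \<gamma>"
    using ab_fact_split_at_alpha[OF assms(2) \<gamma>(1)] by blast
  have lists: "p \<in> lists {a, b}" "set \<gamma> \<subseteq> {a, b}" "q \<in> lists {a, b}"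
    using assms(3) *(1) by auto
  \<comment> \<open>A factor missing one of two letters is a power of the other; for empty
    \<open>\<gamma>\<close> either letter will do.\<close>
  obtain x where x: "x \<in> {a, b}" "set \<gamma> \<subseteq> {x}"
    using lists(2) *(5) by auto
  then have "\<gamma> = replicate (length \<gamma>) x"
    by (metis replicate_length_same singletonD subsetD)
  then show ?thesis
    using infinite_simon_class_pump[OF *(2,3), of k "length \<gamma>" x] x(1) lists \<gamma>(2) *(1,4) by simp
qed

theorem theorem3:
  fixes a b :: 'a and k :: nat and w :: "'a list" and \<alpha> \<beta> :: "nat \<Rightarrow> 'a list"
  assumes "a \<noteq> b"
    and "k \<ge> 1"
    and "w \<in> lists {a, b}"
    and "alpha_beta_fact {a, b} w \<alpha> \<beta>"
  shows "(finite (simon_class {a, b} k w) \<longleftrightarrow> card (simon_class {a, b} k w) = 1) \<and>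
    (card (simon_class {a, b} k w) = 1 \<longleftrightarrow>
      iota {a, b} w < k \<and>
      (\<forall>i \<in> {0..iota {a, b} w}. length (\<alpha> i) < k - iota {a, b} w))"
proof -
  define l where "l = iota {a, b} w"
  define bs where "bs = map (\<lambda>i. (\<beta> i, \<alpha> i)) [1..<l + 1]"
  have ab: "ab_fact {a, b} (\<alpha> 0) bs"
    using alpha_beta_fact_imp_ab_fact[OF assms(3) _ assms(4)] by (simp add: bs_def l_def)
  have w: "w = ab_word (\<alpha> 0) bs"
    using assms(4) unfolding alpha_beta_fact_def ab_word_def bs_def l_def map_map comp_def
      prod.case by (rule conjunct1)
  have len: "length bs = l" by (simp add: bs_def)
  have "{0..l} = insert 0 {1..<l + 1}" by auto
  then have alphas: "insert (\<alpha> 0) (snd ` set bs) = \<alpha> ` {0..l}"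
    by (simp add: bs_def image_image del: upt_Suc)
  have sing: "simon_class {a, b} k w = {w}"
    if iii: "l < k" "\<forall>i \<in> {0..l}. length (\<alpha> i) < k - l"
  proof -
    have "v = w" if v: "v \<in> lists {a, b}" "simon_cong k w v" for v
    proof -
      obtain \<alpha>' bs' where ab': "ab_fact {a, b} \<alpha>' bs'" "v = ab_word \<alpha>' bs'"
        using ab_fact_exists[OF v(1)] by blast
      have cong: "simon_cong k (ab_word (\<alpha> 0) bs) (ab_word \<alpha>' bs')"
        using v(2) w ab'(2) by simp
      have "length bs = length bs'"
        using simon_cong_length_eq[OF ab ab'(1) cong] iii(1) len by simp
      moreover have "\<forall>\<gamma> \<in> insert (\<alpha> 0) (snd ` set bs). length \<gamma> < k - l"
        using alphas iii(2) by auto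
      ultimately have "\<alpha> 0 = \<alpha>' \<and> bs = bs'"
        using binary_ab_fact_unique[OF assms(1) ab ab'(1)] cong len iii(1) by simp
      then show ?thesis using w ab'(2) by simp
    qed
    then show ?thesis
      using assms(3) by (auto simp: simon_class_def simon_cong_def)
  qed
  have inf: "infinite (simon_class {a, b} k w)"
    if "\<not> (l < k \<and> (\<forall>i \<in> {0..l}. length (\<alpha> i) < k - l))"
  proof -
    \<comment> \<open>The additive form avoids the truncated difference
      \<open>k - l\<close>.\<close>
    have "k \<le> l \<or> (\<exists>i \<in> {0..l}. k \<le> l + length (\<alpha> i))"
    proof (rule disjCI)
      assume "\<not> (\<exists>i \<in> {0..l}. k \<le> l + length (\<alpha> i))"
      then have "length (\<alpha> i) < k - l" if "i \<in> {0..l}" for i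
        using that by (simp add: less_diff_conv not_le add.commute)
      with that show "k \<le> l" by (auto simp: not_less)
    qed
    then have "k \<le> length bs \<or> (\<exists>\<gamma> \<in> insert (\<alpha> 0) (snd ` set bs). k \<le> length bs + length \<gamma>)"
      unfolding alphas len by blast
    then show ?thesis
      using binary_infinite_simon_class[OF assms(1) ab] assms(3) w by blast
  qed
  show ?thesis
  proof (cases "l < k \<and> (\<forall>i \<in> {0..l}. length (\<alpha> i) < k - l)")
    case True
    then have "simon_class {a, b} k w = {w}" using sing by blast
    with True show ?thesis
      unfolding l_def[symmetric]
      by simp
  next
    case False
    then have "infinite (simon_class {a, b} k w)" by (rule inf)
    \<comment> \<open>As \<open>card\<close> is 0 on infinite sets, (ii) fails together with
      (i).\<close>
    with False show ?thesis
      unfolding l_def[symmetric]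
      by (simp only: card.infinite zero_neq_one simp_thms)
  qed
qed

end
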